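(* For any constant $\varepsilon > 0$, every (possibly randomized) algorithm for Unconstrained Submodular Maximization (USM) that guarantees an approximation ratio of $1/4 + \varepsilon$ must use $\Omega(n / \log n)$ value oracle queries.
   Context: USM: given a finite ground set $\mathcal{N}$ with $|\mathcal{N}| = n$ and a non-negative (not necessarily monotone) submodular function $f\colon 2^{\mathcal{N}} \to \mathbb{R}_{\geq 0}$ accessible only through a value oracle, output a set $S \subseteq \mathcal{N}$ maximizing $f(S)$. An algorithm guarantees approximation ratio $\gamma$ if its output $S$ satisfies $\mathbb{E}[f(S)] \geq \gamma \cdot \max_{T \subseteq \mathcal{N}} f(T)$ on every instance. *)

theory Defs
  imports "HOL-Probability.Probability" "HOL-Library.Landau_Symbols" "HOL-Library.Extended_Nat"
begin

definition submodular_on :: "'a set \<Rightarrow> ('a set \<Rightarrow> real) \<Rightarrow> bool" where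
  "submodular_on N f \<longleftrightarrow>
    (\<forall>A B. A \<subseteq> N \<longrightarrow> B \<subseteq> N \<longrightarrow> f (A \<union> B) + f (A \<inter> B) \<le> f A + f B)"

text \<open>The objective is a function on the subsets of \<open>N\<close>; its values on other sets are
  irrelevant, and algorithms are not allowed to query or output such sets (see
  \<open>stays_within\<close> below).\<close>

definition usm_instance :: "'a set \<Rightarrow> ('a set \<Rightarrow> real) \<Rightarrow> bool" where
  "usm_instance N f \<longleftrightarrow> submodular_on N f \<and> (\<forall>A. A \<subseteq> N \<longrightarrow> 0 \<le> f A)"

text \<open>A deterministic value oracle algorithm for a fixed ground set is an adaptive decision
  tree: it either stops with an output set, or queries the value of a set and continues
  depending on the real number returned by the oracle. No bound on the computation performed
  between queries is imposed. The tree is well-founded, so every run terminates, but there need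
  not be a common bound on the number of queries.\<close>

datatype 'a oracle_alg = Output "'a set" | Query "'a set" "real \<Rightarrow> 'a oracle_alg"

primrec alg_output :: "'a oracle_alg \<Rightarrow> ('a set \<Rightarrow> real) \<Rightarrow> 'a set" where
  "alg_output (Output S) f = S"
| "alg_output (Query S k) f = alg_output (k (f S)) f"

primrec num_queries :: "'a oracle_alg \<Rightarrow> ('a set \<Rightarrow> real) \<Rightarrow> nat" where
  "num_queries (Output S) f = 0"
| "num_queries (Query S k) f = Suc (num_queries (k (f S)) f)"

primrec stays_within :: "'a set \<Rightarrow> 'a oracle_alg \<Rightarrow> bool" where
  "stays_within N (Output S) \<longleftrightarrow> S \<subseteq> N"
| "stays_within N (Query S k) \<longleftrightarrow> S \<subseteq> N \<and> (\<forall>y. stays_within N (k y))"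

text \<open>A randomized algorithm is an arbitrary probability distribution over deterministic ones;
  the only measurability requirement is that on every instance the output is a random
  variable.\<close>

definition randomized_alg :: "'a set \<Rightarrow> 'a oracle_alg measure \<Rightarrow> bool" where
  "randomized_alg N M \<longleftrightarrow>
     prob_space M \<and>
     (\<forall>T \<in> space M. stays_within N T) \<and>
     (\<forall>f. usm_instance N f \<longrightarrow>
        (\<lambda>T. alg_output T f) \<in> M \<rightarrow>\<^sub>M count_space (Pow N))"

definition guarantees_ratio :: "'a set \<Rightarrow> 'a oracle_alg measure \<Rightarrow> real \<Rightarrow> bool" where
  "guarantees_ratio N M \<gamma> \<longleftrightarrow>
     (\<forall>f. usm_instance N f \<longrightarrow>
        (\<integral>T. f (alg_output T f) \<partial>M) \<ge> \<gamma> * Max (f ` Pow N))"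

text \<open>Worst case over both the instance and the random choices; the value is \<open>\<infinity>\<close> if the
  number of queries is unbounded.\<close>

definition query_complexity :: "'a set \<Rightarrow> 'a oracle_alg measure \<Rightarrow> enat" where
  "query_complexity N M =
     (SUP f \<in> {f. usm_instance N f}. SUP T \<in> space M. enat (num_queries T f))"

end

theory Submission imports Defs "HOL-Real_Asymp.Real_Asymp" begin

text \<open>
  Hide a uniformly random set \<open>T\<close> and let the objective be the cut function of the complete
  bipartite digraph directed from \<open>T\<close> to \<open>N - T\<close>. Every oracle answer is one of at most
  \<open>n\<^sup>2 + 1\<close> integers, so an algorithm making \<open>q\<close> queries can produce at most \<open>(n\<^sup>2 + 1) ^ q\<close>
  different outputs over all choices of \<open>T\<close>. By AM-GM, the value of a fixed output \<open>S\<close> is at most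
  \<open>(m / 2)\<^sup>2\<close>, where \<open>m\<close> counts the elements on which \<open>S\<close> and \<open>T\<close> agree, and \<open>m\<close> is binomially
  distributed with mean \<open>n / 2\<close>. By a Chernoff bound and a union bound over all possible outputs,
  a value noticeably above \<open>n\<^sup>2 / 16\<close> is unlikely unless \<open>(n\<^sup>2 + 1) ^ q\<close> is exponential in \<open>n\<close>,
  whereas the optimum is \<open>n\<^sup>2 / 4\<close> on average, up to lower order terms.
\<close>

section \<open>The directed cut instances\<close>

definition dicut :: "'a set \<Rightarrow> 'a set \<Rightarrow> 'a set \<Rightarrow> real" where
  "dicut N T S = real (card (S \<inter> T) * card (N - T - S))"

text \<open>After the substitutions in the proof, the right side exceeds the left by
  \<open>r * r' + p * p'\<close>. In the application \<open>u\<close> and \<open>i\<close> belong to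
  union and intersection. Unprimed numbers count elements inside the hidden set and primed ones
  count elements missed outside it, which is why the inequalities for the two pairs point in
  opposite directions.\<close>

lemma crossing_product_le:
  fixes a b u i a' b' u' i' :: nat
  assumes "u + i = a + b" "i \<le> a" "i \<le> b" "u' + i' = a' + b'" "u' \<le> a'" "u' \<le> b'"
  shows "u * u' + i * i' \<le> a * a' + b * b'"
proof -
  obtain r p where "a = i + r" "b = i + p"
    using assms by (metis le_Suc_ex)
  moreover obtain r' p' where "a' = u' + r'" "b' = u' + p'"
    using assms by (metis le_Suc_ex)
  moreover have "u = i + r + p" "i' = u' + r' + p'"
    using assms calculation by auto
  ultimately show ?thesis
    by (simp add: algebra_simps)
qed

lemma usm_instance_dicut:
  assumes "finite N" "T \<subseteq> N"
  shows "usm_instance N (dicut N T)"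
proof -
  have "dicut N T (A \<union> B) + dicut N T (A \<inter> B) \<le> dicut N T A + dicut N T B"
    if AB: "A \<subseteq> N" "B \<subseteq> N" for A B
  proof -
    have fin: "finite A" "finite B" "finite T"
      using AB assms by (auto intro: finite_subset)
    have "card ((A \<union> B) \<inter> T) + card ((A \<inter> B) \<inter> T) = card (A \<inter> T) + card (B \<inter> T)"
      using card_Un_Int[of "A \<inter> T" "B \<inter> T"] fin
      by (simp add: Int_Un_distrib2 Int_assoc Int_left_commute)
    moreover have "card (N - T - (A \<union> B)) + card (N - T - (A \<inter> B))
        = card (N - T - A) + card (N - T - B)"
      using card_Un_Int[of "N - T - A" "N - T - B"] assms(1)
      by (simp add: Diff_Int Diff_Un)
    ultimately have "card ((A \<union> B) \<inter> T) * card (N - T - (A \<union> B))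
          + card ((A \<inter> B) \<inter> T) * card (N - T - (A \<inter> B))
        \<le> card (A \<inter> T) * card (N - T - A) + card (B \<inter> T) * card (N - T - B)"
      using fin assms(1) by (intro crossing_product_le) (auto intro!: card_mono)
    then show ?thesis
      unfolding dicut_def of_nat_add [symmetric] of_nat_le_iff .
  qed
  then show ?thesis
    by (auto simp: usm_instance_def submodular_on_def dicut_def)
qed

lemma dicut_in_values:
  assumes "finite N" "T \<subseteq> N"
  shows "dicut N T S \<in> real ` {..(card N)\<^sup>2}"
proof -
  have "card (S \<inter> T) * card (N - T - S) \<le> card N * card N"
    using assms by (intro mult_mono card_mono) auto
  then show ?thesis
    unfolding dicut_def power2_eq_square by (intro imageI) simp
qed

lemma dicut_le_agreement:
  assumes "finite N" "T \<subseteq> N" "S \<subseteq> N"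
  shows "dicut N T S \<le> (real (card ((S \<inter> T) \<union> (N - T - S))) / 2)\<^sup>2"
proof -
  have "finite (S \<inter> T)"
    using assms by (meson finite_Int finite_subset)
  then have "card ((S \<inter> T) \<union> (N - T - S)) = card (S \<inter> T) + card (N - T - S)"
    using assms by (intro card_Un_disjoint) auto
  moreover have "x * y \<le> ((x + y) / 2)\<^sup>2" for x y :: real
    using zero_le_power2[of "x - y"] by (simp add: power2_eq_square field_simps)
  ultimately show ?thesis
    by (simp add: dicut_def)
qed

section \<open>Sums over the power set and a Chernoff bound\<close>

lemma sum_Pow_insert:
  fixes h :: "'a set \<Rightarrow> 'b::comm_monoid_add"
  assumes "finite N" "x \<notin> N"
  shows "(\<Sum>T\<in>Pow (insert x N). h T) = (\<Sum>T\<in>Pow N. h T) + (\<Sum>T\<in>Pow N. h (insert x T))"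
proof -
  have "inj_on (insert x) (Pow N)"
    using assms(2) by (auto simp: inj_on_def)
  moreover have "Pow N \<inter> insert x ` Pow N = {}"
    using assms(2) by auto
  ultimately show ?thesis
    using assms(1) by (simp add: Pow_insert sum.union_disjoint sum.reindex)
qed

lemma sum_Pow_power_card:
  fixes x :: real
  assumes "finite N"
  shows "(\<Sum>T\<in>Pow N. x ^ card T) = (1 + x) ^ card N"
  using assms
proof (induction N)
  case (insert a N)
  have "card (insert a T) = Suc (card T)" if "T \<in> Pow N" for T
    using that insert.hyps finite_subset[of T N] by (intro card_insert_disjoint) auto
  then have "(\<Sum>T\<in>Pow N. x ^ card (insert a T)) = (\<Sum>T\<in>Pow N. x * x ^ card T)"
    by simp
  then show ?case
    using insert by (simp add: sum_Pow_insert algebra_simps flip: sum_distrib_left)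
qed simp

text \<open>Each of the \<open>n * (n - 1)\<close> ordered pairs of distinct elements has its first
  element in \<open>T\<close> and its second outside for a quarter of all \<open>T\<close>. This
  supplies the lower bound on the average optimum.\<close>

lemma sum_dicut_self:
  assumes "finite N"
  shows "(\<Sum>T\<in>Pow N. dicut N T T) = 2 ^ card N * (real (card N) * (real (card N) - 1)) / 4"
proof -
  have eq: "dicut N T T = real (card T) * (real (card N) - real (card T))"
    if "finite N" "T \<in> Pow N" for N T :: "'a set"
    using that card_mono[of N T] finite_subset[of T N]
    by (auto simp: dicut_def card_Diff_subset of_nat_diff)
  have "(\<Sum>T\<in>Pow N. real (card T) * (real (card N) - real (card T)))
      = 2 ^ card N * (real (card N) * (real (card N) - 1)) / 4"
    using assms
  proof (induction N)
    case (insert a N)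
    let ?n = "real (card N)"
    have ins: "card (insert a T) = Suc (card T)" if "T \<in> Pow N" for T
      using that insert.hyps finite_subset[of T N] by (intro card_insert_disjoint) auto
    have "(\<Sum>T\<in>Pow (insert a N). real (card T) * (real (card (insert a N)) - real (card T)))
        = (\<Sum>T\<in>Pow N. real (card T) * (?n + 1 - real (card T)))
          + (\<Sum>T\<in>Pow N. (real (card T) + 1) * (?n - real (card T)))"
      using insert.hyps ins by (simp add: sum_Pow_insert add.commute)
    also have "\<dots> = (\<Sum>T\<in>Pow N. 2 * (real (card T) * (?n - real (card T))) + ?n)"
      unfolding sum.distrib [symmetric] by (intro sum.cong) (auto simp: algebra_simps)
    also have "\<dots> = 2 * (2 ^ card N * (?n * (?n - 1)) / 4) + 2 ^ card N * ?n"
      unfolding sum.distrib sum_distrib_left [symmetric] insert.IH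
      using insert.hyps by (simp add: card_Pow)
    finally show ?case
      using insert.hyps by (simp add: field_simps)
  qed simp
  then show ?thesis
    using assms by (simp add: eq)
qed

text \<open>Exponential moment method: weight each \<open>U\<close> by
  \<open>exp (\<delta> * card U)\<close>, with \<open>\<delta>\<close> itself as the parameter. The
  total weight is \<open>(1 + exp \<delta>) ^ n\<close>, and
  \<open>exp \<delta> \<le> 1 + \<delta> + \<delta>\<^sup>2\<close> on the unit interval turns this
  into the stated exponent.\<close>

lemma card_large_subsets_le:
  fixes \<delta> :: real
  assumes "finite N" "0 \<le> \<delta>" "\<delta> \<le> 1"
  shows "real (card {U \<in> Pow N. real (card U) > (1/2 + \<delta>) * real (card N)})
    \<le> 2 ^ card N * exp (- (real (card N) * \<delta>\<^sup>2 / 2))"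
proof -
  let ?n = "real (card N)"
  let ?L = "{U \<in> Pow N. real (card U) > (1/2 + \<delta>) * ?n}"
  have "real (card ?L) * exp (\<delta> * ((1/2 + \<delta>) * ?n)) = (\<Sum>U\<in>?L. exp (\<delta> * ((1/2 + \<delta>) * ?n)))"
    by simp
  also have "\<dots> \<le> (\<Sum>U\<in>?L. exp (\<delta> * real (card U)))"
    using assms by (intro sum_mono) (auto intro: mult_left_mono)
  also have "\<dots> \<le> (\<Sum>U\<in>Pow N. exp (\<delta> * real (card U)))"
    using assms by (intro sum_mono2) auto
  also have "\<dots> = (1 + exp \<delta>) ^ card N"
    using sum_Pow_power_card[OF assms(1), of "exp \<delta>"]
    by (simp add: exp_of_nat_mult[symmetric] mult.commute)
  also have "\<dots> \<le> (2 * exp (\<delta>/2 + \<delta>\<^sup>2/2)) ^ card N"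
  proof (intro power_mono)
    have "1 + exp \<delta> \<le> 2 * (1 + (\<delta>/2 + \<delta>\<^sup>2/2))"
      using exp_bound[OF assms(2,3)] by simp
    also have "\<dots> \<le> 2 * exp (\<delta>/2 + \<delta>\<^sup>2/2)"
      using exp_ge_add_one_self[of "\<delta>/2 + \<delta>\<^sup>2/2"] by (intro mult_left_mono) auto
    finally show "1 + exp \<delta> \<le> 2 * exp (\<delta>/2 + \<delta>\<^sup>2/2)" .
  qed (simp add: add_nonneg_nonneg)
  also have "\<dots> = 2 ^ card N * exp (?n * (\<delta>/2 + \<delta>\<^sup>2/2))"
    by (simp add: power_mult_distrib exp_of_nat_mult)
  also have "\<dots> = 2 ^ card N * exp (- (?n * \<delta>\<^sup>2 / 2)) * exp (\<delta> * ((1/2 + \<delta>) * ?n))"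
    by (simp add: mult.assoc flip: exp_add) (simp add: algebra_simps power2_eq_square)
  finally show ?thesis
    by simp
qed

text \<open>For fixed \<open>S\<close>, sending \<open>T\<close> to the set where \<open>S\<close>
  and \<open>T\<close> agree is an involution on \<open>Pow N\<close>, so the sets \<open>T\<close>
  agreeing too much inject into the large subsets.\<close>

lemma card_agreeing_sets_le:
  fixes \<delta> :: real
  assumes "finite N" "S \<subseteq> N" "0 \<le> \<delta>" "\<delta> \<le> 1"
  shows "real (card {T \<in> Pow N. real (card ((S \<inter> T) \<union> (N - T - S))) > (1/2 + \<delta>) * real (card N)})
    \<le> 2 ^ card N * exp (- (real (card N) * \<delta>\<^sup>2 / 2))"
    (is "real (card ?B) \<le> _")
proof -
  let ?L = "{U \<in> Pow N. real (card U) > (1/2 + \<delta>) * real (card N)}"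
  let ?h = "\<lambda>T. (S \<inter> T) \<union> (N - T - S)"
  have "T = ?h (?h T)" if "T \<in> Pow N" for T
    using that assms(2) by auto
  then have "inj_on ?h ?B"
    by (intro inj_on_inverseI[of _ ?h]) simp
  moreover have "?h ` ?B \<subseteq> ?L"
    using assms(2) by auto
  ultimately have "card ?B \<le> card ?L"
    using assms(1) by (intro card_inj_on_le) auto
  then show ?thesis
    using card_large_subsets_le[OF assms(1,3,4)] by linarith
qed

section \<open>Counting the outputs of a decision tree\<close>

lemma stays_within_alg_output: "stays_within N A \<Longrightarrow> alg_output A f \<subseteq> N"
  by (induction A) auto

text \<open>On inputs from \<open>F\<close> a query node has at most \<open>card V\<close> live
  branches, so at most \<open>card V ^ q\<close> leaves are reached. \<open>F\<close> is generalized
  in the induction because each branch keeps only the functions giving that answer.\<close>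

lemma card_alg_outputs_le:
  assumes "finite V" "\<And>f S. f \<in> F \<Longrightarrow> f S \<in> V" "\<And>f. f \<in> F \<Longrightarrow> num_queries A f \<le> q"
  shows "finite (alg_output A ` F) \<and> card (alg_output A ` F) \<le> card V ^ q"
  using assms(2,3)
proof (induction A arbitrary: F q)
  case (Output S)
  show ?case
  proof (cases "F = {}")
    case False
    \<comment> \<open>Needed so that \<open>card V ^ q\<close> is at least 1 even for positive
      \<open>q\<close>.\<close>
    then have "V \<noteq> {}"
      using Output by blast
    then have "card V \<ge> 1"
      using assms(1) by (simp add: Suc_le_eq card_gt_0_iff)
    then show ?thesis
      using False by (simp add: image_constant_conv)
  qed simp
next
  case (Query S k)
  show ?case
  proof (cases q)
    case 0
    then have "F = {}"
      using Query.prems(2) by fastforce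
    then show ?thesis
      by simp
  next
    case (Suc p)
    let ?O = "\<lambda>v. alg_output (k v) ` {f \<in> F. f S = v}"
    have IH: "finite (?O v) \<and> card (?O v) \<le> card V ^ p" for v
      using Query.prems Suc by (intro Query.IH) force+
    have eq: "alg_output (Query S k) ` F = (\<Union>v\<in>V. ?O v)"
      using Query.prems(1) by auto
    have "card (\<Union>v\<in>V. ?O v) \<le> (\<Sum>v\<in>V. card (?O v))"
      using assms(1) by (rule card_UN_le)
    also have "\<dots> \<le> (\<Sum>v\<in>V. card V ^ p)"
      using IH by (intro sum_mono) blast
    finally show ?thesis
      using assms(1) IH Suc unfolding eq by simp
  qed
qed

section \<open>Averaging over the hidden set\<close>

lemma sum_dicut_output_le:
  fixes \<delta> :: real
  assumes N: "finite N" and A: "stays_within N A" and \<delta>: "0 \<le> \<delta>" "\<delta> \<le> 1"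
    and q: "\<And>T. T \<subseteq> N \<Longrightarrow> num_queries A (dicut N T) \<le> q"
  shows "(\<Sum>T\<in>Pow N. dicut N T (alg_output A (dicut N T)))
    \<le> 2 ^ card N * (real (card N))\<^sup>2 / 4 *
      ((1/2 + \<delta>)\<^sup>2 + (real (card N) ^ 2 + 1) ^ q * exp (- (real (card N) * \<delta>\<^sup>2 / 2)))"
proof -
  let ?n = "real (card N)"
  let ?e = "exp (- (?n * \<delta>\<^sup>2 / 2))"
  let ?out = "\<lambda>T. alg_output A (dicut N T)"
  let ?m = "\<lambda>S T. real (card ((S \<inter> T) \<union> (N - T - S)))"
  let ?Out = "alg_output A ` dicut N ` Pow N"
  \<comment> \<open>The output depends on \<open>T\<close>, so the tail bound cannot be applied to
    it directly. Hence \<open>B\<close> collects the hidden sets that agree too much with any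
    reachable output, and a union bound controls its size.\<close>
  define Bad where "Bad S = {T \<in> Pow N. ?m S T > (1/2 + \<delta>) * ?n}" for S
  define B where "B = (\<Union>S\<in>?Out. Bad S)"
  have Out: "finite ?Out" "card ?Out \<le> Suc ((card N)\<^sup>2) ^ q"
  proof -
    have "finite ?Out \<and> card ?Out \<le> card (real ` {..(card N)\<^sup>2}) ^ q"
      using N q by (intro card_alg_outputs_le) (use dicut_in_values in blast)+
    then show "finite ?Out" "card ?Out \<le> Suc ((card N)\<^sup>2) ^ q"
      by (simp_all add: card_image inj_on_def)
  qed
  have outN: "?out T \<subseteq> N" for T
    using A by (rule stays_within_alg_output)
  have "card B \<le> (\<Sum>S\<in>?Out. card (Bad S))"
    unfolding B_def using Out(1) by (rule card_UN_le)
  then have "real (card B) \<le> (\<Sum>S\<in>?Out. real (card (Bad S)))"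
    by (simp flip: of_nat_sum)
  also have "\<dots> \<le> (\<Sum>S\<in>?Out. 2 ^ card N * ?e)"
    unfolding Bad_def using N \<delta> outN by (intro sum_mono card_agreeing_sets_le) auto
  also have "\<dots> = real (card ?Out) * (2 ^ card N * ?e)"
    by simp
  also have "\<dots> \<le> (?n ^ 2 + 1) ^ q * (2 ^ card N * ?e)"
  proof (intro mult_right_mono)
    have "real (card ?Out) \<le> real (Suc ((card N)\<^sup>2) ^ q)"
      using Out(2) by (simp only: of_nat_le_iff)
    then show "real (card ?Out) \<le> (?n ^ 2 + 1) ^ q"
      by (simp add: add.commute)
  qed simp
  finally have cardB: "real (card B) \<le> (?n ^ 2 + 1) ^ q * (2 ^ card N * ?e)" .
  \<comment> \<open>Outside \<open>B\<close> the agreement is small; on \<open>B\<close> only the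
    trivial bound by \<open>n\<close> is used.\<close>
  have pt: "dicut N T (?out T) \<le> ((1/2 + \<delta>) * ?n / 2)\<^sup>2 + (if T \<in> B then (?n / 2)\<^sup>2 else 0)"
    if T: "T \<in> Pow N" for T
  proof -
    have le: "dicut N T (?out T) \<le> (?m (?out T) T / 2)\<^sup>2"
      using N T outN by (intro dicut_le_agreement) auto
    show ?thesis
    proof (cases "T \<in> B")
      case True
      have "?m (?out T) T \<le> ?n"
        using N outN[of T] by (simp, intro card_mono) auto
      then have "(?m (?out T) T / 2)\<^sup>2 \<le> (?n / 2)\<^sup>2"
        by (intro power_mono) auto
      then show ?thesis
        using True le zero_le_power2[of "(1/2 + \<delta>) * ?n / 2"] unfolding if_P[OF True] by linarith
    next
      case False
      then have "T \<notin> Bad (?out T)"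
        using T unfolding B_def by blast
      then have "?m (?out T) T \<le> (1/2 + \<delta>) * ?n"
        using T by (simp add: Bad_def not_less)
      then have "(?m (?out T) T / 2)\<^sup>2 \<le> ((1/2 + \<delta>) * ?n / 2)\<^sup>2"
        by (intro power_mono) auto
      then show ?thesis
        using False le by simp
    qed
  qed
  have BN: "Pow N \<inter> B = B"
    by (auto simp: B_def Bad_def)
  have "(\<Sum>T\<in>Pow N. dicut N T (?out T))
      \<le> (\<Sum>T\<in>Pow N. ((1/2 + \<delta>) * ?n / 2)\<^sup>2 + (if T \<in> B then (?n / 2)\<^sup>2 else 0))"
    using pt by (rule sum_mono)
  also have "\<dots> = 2 ^ card N * ((1/2 + \<delta>) * ?n / 2)\<^sup>2 + real (card B) * (?n / 2)\<^sup>2"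
    using N by (simp add: sum.distrib card_Pow BN flip: sum.inter_restrict)
  also have "\<dots> \<le> 2 ^ card N * ((1/2 + \<delta>) * ?n / 2)\<^sup>2
      + (?n ^ 2 + 1) ^ q * (2 ^ card N * ?e) * (?n / 2)\<^sup>2"
    using cardB by (intro add_left_mono mult_right_mono) auto
  also have "\<dots> = 2 ^ card N * ?n\<^sup>2 / 4 * ((1/2 + \<delta>)\<^sup>2 + (?n ^ 2 + 1) ^ q * ?e)"
    by (simp add: power2_eq_square algebra_simps)
  finally show ?thesis .
qed

text \<open>Yao's principle: the guarantee is summed over all hidden sets, sum and expectation are
  exchanged, and the bound for deterministic trees then holds for every tree in the support
  space.\<close>

lemma ratio_le_of_bounded_queries:
  fixes \<gamma> \<delta> :: real
  assumes N: "finite N" and M: "randomized_alg N M" and ratio: "guarantees_ratio N M \<gamma>"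
    and \<gamma>: "0 \<le> \<gamma>" and \<delta>: "0 \<le> \<delta>" "\<delta> \<le> 1" and q: "query_complexity N M \<le> enat q"
  shows "\<gamma> * (2 ^ card N * (real (card N) * (real (card N) - 1)) / 4)
    \<le> 2 ^ card N * (real (card N))\<^sup>2 / 4 *
      ((1/2 + \<delta>)\<^sup>2 + (real (card N) ^ 2 + 1) ^ q * exp (- (real (card N) * \<delta>\<^sup>2 / 2)))"
    (is "_ \<le> ?R")
proof -
  interpret prob_space M
    using M by (simp add: randomized_alg_def)
  let ?val = "\<lambda>T A. dicut N T (alg_output A (dicut N T))"
  have inst: "usm_instance N (dicut N T)" if "T \<in> Pow N" for T
    using that N by (simp add: usm_instance_dicut)
  have int: "integrable M (?val T)" if "T \<in> Pow N" for T
  proof (rule integrable_const_bound)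
    \<comment> \<open>Every real function on a discrete space is measurable, so measurability of the
      output suffices.\<close>
    have "(\<lambda>A. alg_output A (dicut N T)) \<in> M \<rightarrow>\<^sub>M count_space (Pow N)"
      using M inst[OF that] by (simp add: randomized_alg_def)
    then show "?val T \<in> borel_measurable M"
      by (rule measurable_compose) simp
    have "norm (dicut N T S) \<le> real ((card N)\<^sup>2)" for S
      using dicut_in_values[OF N, of T S] that by auto
    then show "AE A in M. norm (?val T A) \<le> real ((card N)\<^sup>2)"
      by simp
  qed
  have "num_queries A (dicut N T) \<le> q" if "A \<in> space M" "T \<subseteq> N" for A T
  proof -
    have "enat (num_queries A (dicut N T)) \<le> query_complexity N M"
      unfolding query_complexity_def using that inst
      by (intro SUP_upper2[of "dicut N T"] SUP_upper2[of A]) auto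
    then show ?thesis
      using q by (meson enat_ord_simps(1) order_trans)
  qed
  then have le: "(\<Sum>T\<in>Pow N. ?val T A) \<le> ?R" if "A \<in> space M" for A
    using that N M \<delta> by (intro sum_dicut_output_le) (auto simp: randomized_alg_def)
  have "\<gamma> * (2 ^ card N * (real (card N) * (real (card N) - 1)) / 4)
      = (\<Sum>T\<in>Pow N. \<gamma> * dicut N T T)"
    using sum_dicut_self[OF N] by (simp flip: sum_distrib_left)
  also have "\<dots> \<le> (\<Sum>T\<in>Pow N. \<integral>A. ?val T A \<partial>M)"
  proof (rule sum_mono)
    fix T assume T: "T \<in> Pow N"
    \<comment> \<open>The hidden set itself is a feasible solution, so its value bounds the optimum
      from below.\<close>
    have "\<gamma> * dicut N T T \<le> \<gamma> * Max (dicut N T ` Pow N)"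
      using N T \<gamma> by (intro mult_left_mono Max_ge) auto
    also have "\<dots> \<le> (\<integral>A. ?val T A \<partial>M)"
      using ratio inst[OF T] by (simp add: guarantees_ratio_def)
    finally show "\<gamma> * dicut N T T \<le> (\<integral>A. ?val T A \<partial>M)" .
  qed
  also have "\<dots> = (\<integral>A. (\<Sum>T\<in>Pow N. ?val T A) \<partial>M)"
    using int by simp
  also have "\<dots> \<le> (\<integral>A. ?R \<partial>M)"
    using int le by (intro integral_mono) auto
  also have "\<dots> = ?R"
    by (simp add: prob_space)
  finally show ?thesis .
qed

section \<open>Choice of constants and asymptotics\<close>

lemma guarantees_ratio_mono:
  assumes "finite N" "guarantees_ratio N M \<gamma>" "\<gamma>' \<le> \<gamma>"
  shows "guarantees_ratio N M \<gamma>'"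
  unfolding guarantees_ratio_def
proof (intro allI impI)
  fix f assume f: "usm_instance N f"
  \<comment> \<open>The optimum is non-negative, so lowering the ratio weakens the
    guarantee.\<close>
  have "f {} \<le> Max (f ` Pow N)"
    using assms(1) by (intro Max_ge) auto
  then have "0 \<le> Max (f ` Pow N)"
    using f order_trans[of 0 "f {}"] by (simp add: usm_instance_def)
  then have "\<gamma>' * Max (f ` Pow N) \<le> \<gamma> * Max (f ` Pow N)"
    using assms(3) by (intro mult_right_mono)
  then show "\<gamma>' * Max (f ` Pow N) \<le> (\<integral>T. f (alg_output T f) \<partial>M)"
    using assms(2) f by (force simp: guarantees_ratio_def)
qed

text \<open>For \<open>n \<ge> 2\<close> each query has at most
  \<open>n\<^sup>2 + 1 \<le> n ^ 3 = exp (3 * ln n)\<close> answers. This is the source of the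
  logarithm in the final bound.\<close>

lemma num_outputs_le_exp:
  fixes c :: real
  assumes "n \<ge> 2" "real q \<le> c * (real n / ln (real n))"
  shows "(real n ^ 2 + 1) ^ q \<le> exp (3 * c * real n)"
proof -
  have ln: "ln (real n) > 0"
    using assms(1) by simp
  have "real n ^ 2 + 1 \<le> 2 * real n ^ 2"
    using assms(1) by (simp add: one_le_power)
  also have "\<dots> \<le> real n * real n ^ 2"
    using assms(1) by (intro mult_right_mono) auto
  also have "\<dots> = exp (ln (real n)) ^ 3"
    using assms(1) by (simp add: power2_eq_square power3_eq_cube)
  also have "\<dots> = exp (3 * ln (real n))"
    by (simp flip: exp_of_nat_mult)
  finally have "(real n ^ 2 + 1) ^ q \<le> exp (3 * ln (real n)) ^ q"
    by (intro power_mono) auto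
  also have "\<dots> = exp (3 * (real q * ln (real n)))"
    by (simp add: mult_ac flip: exp_of_nat_mult)
  also have "\<dots> \<le> exp (3 * c * real n)"
    using assms(2) ln by (simp add: field_simps)
  finally show ?thesis .
qed

text \<open>The constant \<open>\<delta>\<^sup>2 / 12\<close> lets the number of outputs use up only
  half of the Chernoff exponent, leaving an error below \<open>\<epsilon> / 2\<close>. The choice
  \<open>\<delta> = \<epsilon> / 8\<close> costs another \<open>\<epsilon> / 4\<close>, so a slack
  of \<open>\<epsilon> / 4\<close> in the ratio remains to absorb the lower order terms.\<close>

lemma query_complexity_not_le:
  fixes \<epsilon> \<delta> :: real
  assumes \<epsilon>: "0 < \<epsilon>" "\<epsilon> \<le> 1" and \<delta>: "\<delta> = \<epsilon> / 8"
    and N: "finite N" and M: "randomized_alg N M" and ratio: "guarantees_ratio N M (1/4 + \<epsilon>)"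
    and n: "card N \<ge> 2" "5 \<le> \<epsilon> * real (card N)"
      "exp (- (\<delta>\<^sup>2 / 4 * real (card N))) < \<epsilon> / 2"
    and q: "real q \<le> \<delta>\<^sup>2 / 12 * (real (card N) / ln (real (card N)))"
  shows "\<not> query_complexity N M \<le> enat q"
proof
  let ?n = "real (card N)"
  let ?e = "exp (- (?n * \<delta>\<^sup>2 / 2))"
  assume le: "query_complexity N M \<le> enat q"
  have n0: "?n > 0"
    using n(1) by simp
  have "(?n ^ 2 + 1) ^ q * ?e \<le> exp (3 * (\<delta>\<^sup>2 / 12) * ?n) * ?e"
    using num_outputs_le_exp[OF n(1) q] by (intro mult_right_mono) auto
  also have "\<dots> = exp (- (\<delta>\<^sup>2 / 4 * ?n))"
    by (simp flip: exp_add)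
  finally have small: "(?n ^ 2 + 1) ^ q * ?e < \<epsilon> / 2"
    using n(3) by linarith
  have "\<delta> * \<delta> \<le> \<delta> * 1"
    using \<epsilon> \<delta> by (intro mult_left_mono) auto
  moreover have "\<epsilon> = 8 * \<delta>"
    using \<delta> by simp
  ultimately have sq: "(1/2 + \<delta>)\<^sup>2 \<le> 1/4 + \<epsilon> / 4"
    by (simp add: power2_eq_square algebra_simps)
  have "(1/4 + \<epsilon>) * (2 ^ card N * (?n * (?n - 1)) / 4)
      \<le> 2 ^ card N * ?n\<^sup>2 / 4 * ((1/2 + \<delta>)\<^sup>2 + (?n ^ 2 + 1) ^ q * ?e)"
    using \<epsilon> \<delta> by (intro ratio_le_of_bounded_queries[OF N M ratio _ _ _ le]) auto
  then have "(2 ^ card N * ?n / 4) * ((1/4 + \<epsilon>) * (?n - 1))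
      \<le> (2 ^ card N * ?n / 4) * (?n * ((1/2 + \<delta>)\<^sup>2 + (?n ^ 2 + 1) ^ q * ?e))"
    by (simp add: power2_eq_square mult_ac)
  then have "(1/4 + \<epsilon>) * (?n - 1) \<le> ?n * ((1/2 + \<delta>)\<^sup>2 + (?n ^ 2 + 1) ^ q * ?e)"
    using n0 by (subst (asm) mult_le_cancel_left_pos) auto
  also have "\<dots> < ?n * (1/4 + \<epsilon> / 4 + \<epsilon> / 2)"
    using small sq n0 by (intro mult_strict_left_mono) auto
  finally have "\<epsilon> * ?n < 1 + 4 * \<epsilon>"
    by (simp add: field_simps)
  \<comment> \<open>Since \<open>\<epsilon> \<le> 1\<close>, the right side is at most 5.\<close>
  then show False
    using n(2) \<epsilon> by simp
qed

theorem theorem6: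
  fixes \<epsilon> :: real
  assumes "\<epsilon> > 0"
  shows "\<exists>g :: nat \<Rightarrow> nat.
    (\<lambda>n. real (g n)) \<in> \<Omega>(\<lambda>n. real n / ln (real n)) \<and>
    (\<forall>(N :: 'a set) M.
       finite N \<longrightarrow> randomized_alg N M \<longrightarrow> guarantees_ratio N M (1/4 + \<epsilon>) \<longrightarrow>
       query_complexity N M \<ge> enat (g (card N)))"
proof -
  \<comment> \<open>Capping at 1 keeps \<open>\<delta>\<close> in the range of the Chernoff bound
    and makes the threshold 5 in \<open>P\<close> sufficient.\<close>
  define \<eta> where "\<eta> = min \<epsilon> 1"
  define \<delta> where "\<delta> = \<eta> / 8"
  define c where "c = \<delta>\<^sup>2 / 12"
  define P where "P n \<longleftrightarrow> n \<ge> 2 \<and> 5 \<le> \<eta> * real n \<and> exp (- (\<delta>\<^sup>2 / 4 * real n)) < \<eta> / 2" for n :: nat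
  \<comment> \<open>Where \<open>n\<close> is too small for the estimates, the value 0 makes the
    claim trivial without affecting the growth rate.\<close>
  define g where "g n = (if P n then nat \<lfloor>c * (real n / ln (real n))\<rfloor> else 0)" for n :: nat
  have \<eta>: "0 < \<eta>" "\<eta> \<le> 1"
    using assms by (auto simp: \<eta>_def)
  then have \<delta>: "\<delta> > 0" and c: "c > 0"
    by (auto simp: \<delta>_def c_def)
  have "eventually (\<lambda>n :: nat. 5 \<le> \<eta> * real n) sequentially"
    using \<eta>(1) by real_asymp
  moreover have "((\<lambda>n :: nat. exp (- (\<delta>\<^sup>2 / 4 * real n))) \<longlongrightarrow> 0) sequentially"
    using \<delta> by real_asymp
  then have "eventually (\<lambda>n :: nat. exp (- (\<delta>\<^sup>2 / 4 * real n)) < \<eta> / 2) sequentially"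
    using \<eta>(1) by (intro order_tendstoD) auto
  ultimately have P: "eventually P sequentially"
    unfolding P_def using eventually_ge_at_top[of 2] by eventually_elim auto
  have "(\<lambda>n. real (g n)) \<in> \<Omega>(\<lambda>n. real n / ln (real n))"
  proof (rule landau_omega.bigI)
    show "c / 2 > 0"
      using c by simp
    \<comment> \<open>From 2 on, the loss of at most 1 by rounding down is at most half, hence the
      constant \<open>c / 2\<close>.\<close>
    have "eventually (\<lambda>n :: nat. 2 \<le> c * (real n / ln (real n))) sequentially"
      using c by real_asymp
    then show "eventually (\<lambda>n. norm (real (g n)) \<ge> c / 2 * norm (real n / ln (real n))) sequentially"
      using P
    proof eventually_elim
      case (elim n)
      have "real n / ln (real n) \<ge> 0"
        using elim(2) by (simp add: P_def)
      moreover have "real (g n) \<ge> c * (real n / ln (real n)) - 1"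
        using elim unfolding g_def by simp
      ultimately show ?case
        using elim(1) by simp
    qed
  qed
  moreover have "query_complexity N M \<ge> enat (g (card N))"
    if N: "finite N" and M: "randomized_alg N M" and ratio: "guarantees_ratio N M (1/4 + \<epsilon>)"
    for N :: "'a set" and M
  proof (cases "P (card N)")
    case True
    have "real (g (card N)) \<le> \<delta>\<^sup>2 / 12 * (real (card N) / ln (real (card N)))"
      using True c by (simp add: g_def P_def flip: c_def)
    moreover have "guarantees_ratio N M (1/4 + \<eta>)"
      using N ratio by (rule guarantees_ratio_mono) (simp add: \<eta>_def)
    ultimately have "\<not> query_complexity N M \<le> enat (g (card N))"
      using True N M \<eta> unfolding P_def
      by (intro query_complexity_not_le[of \<eta> \<delta>]) (auto simp: \<delta>_def)
    then show ?thesis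
      by simp
  next
    case False
    then show ?thesis
      by (simp add: g_def zero_enat_def[symmetric])
  qed
  ultimately show ?thesis
    by blast
qed

end
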